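(* Let $\mathcal{A}\in\mathbb{R}^{J_1\times J_2\times J_1\times J_2}$, $\mathcal{B}\in\mathbb{R}^{J_1\times J_2\times K_1\times K_2}$, $\mathcal{C}\in\mathbb{R}^{I_1\times I_2\times J_1\times J_2}$, and let $V_1,\dots,V_{m+1}$, $\mathcal{V}_m$, $H_{i,j}$, $\mathcal{H}_m$ be produced by $m$ steps of the tensor rational block Arnoldi process (described in the context) applied to $(\mathcal{A},\mathcal{B})$ with real interpolation points $\sigma_1,\dots,\sigma_m$, where the last point is $\sigma_m=0$, and suppose that $\mathcal{H}_m$ is invertible. Set $$\mathcal{A}_m=\mathcal{V}_m^T*\mathcal{A}*\mathcal{V}_m,\qquad \mathcal{B}_m=\mathcal{V}_m^T*\mathcal{B},\qquad \mathcal{C}_m=\mathcal{C}*\mathcal{V}_m ,$$ and, for $s\in\mathbb{C}$ such that $s\mathcal{I}-\mathcal{A}$ and $s\mathcal{I}_m-\mathcal{A}_m$ are invertible, $$\mathcal{F}(s)=\mathcal{C}*(s\mathcal{I}-\mathcal{A})^{-1}*\mathcal{B},\qquad \mathcal{F}_m(s)=\mathcal{C}_m*(s\mathcal{I}_m-\mathcal{A}_m)^{-1}*\mathcal{B}_m .$$ Then for every such $s$, $$\|\mathcal{F}(s)-\mathcal{F}_m(s)\|\le \big\|\mathcal{C}*(s\mathcal{I}-\mathcal{A})^{-1}\big\|\;\cdot\;\big\|\mathcal{A}*V_{m+1}*H_{m+1,m}*\mathcal{E}_m^T*\mathcal{H}_m^{-1}*(s\mathcal{I}_m-\mathcal{A}_m)^{-1}*\mathcal{B}_m\big\|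 .$$
   Context: All tensors are 4th-order. For $\mathcal{X}$ of size $P_1\times P_2\times Q_1\times Q_2$ and $\mathcal{Y}$ of size $Q_1\times Q_2\times R_1\times R_2$, the Einstein product $\mathcal{X}*\mathcal{Y}$ has size $P_1\times P_2\times R_1\times R_2$ and entries $(\mathcal{X}*\mathcal{Y})_{p_1p_2r_1r_2}=\sum_{q_1,q_2}x_{p_1p_2q_1q_2}\,y_{q_1q_2r_1r_2}$. The transpose is $(\mathcal{X}^T)_{q_1q_2p_1p_2}=x_{p_1p_2q_1q_2}$. The identity tensor has entries $1$ when $(p_1,p_2)=(q_1,q_2)$ and $0$ otherwise; $\mathcal{I}$ is the identity of size $J_1\times J_2\times J_1\times J_2$ and $\mathcal{I}_m$ the identity of size $K_1\times mK_2\times K_1\times mK_2$. A square tensor (size $P_1\times P_2\times P_1\times P_2$) is invertible if it has a two-sided inverse for $*$. $\|\cdot\|$ is the Frobenius norm (square root of the sum of squared moduli of the entries). Block notation: $\mathcal{V}_m=|V_1\ \cdots\ V_m|\in\mathbb{R}^{J_1\times J_2\times K_1\times mK_2}$ is the concatenation of the $V_j\in\mathbb{R}^{J_1\times J_2\times K_1\times K_2}$ along the fourth mode, i.e. $\mathcal{V}_m(:,:,:,(j-1)K_2+1:jK_2)=V_j$. A block tensor in $\mathbb{R}^{K_1\times mK_2\times K_1\times mK_2}$ has $(i,j)$ block equal to the subtensor $(:,(i-1)K_2+1:iK_2,:,(j-1)K_2+1:jK_2)\in\mathbb{R}^{K_1\times K_2\times K_1\times K_2}$. $\mathcal{E}_m=\mathcal{I}_m(:,:,:,(m-1)K_2+1:mK_2)\in\mathbb{R}^{K_1\times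 mK_2\times K_1\times K_2}$. Tensor rational block Arnoldi process with points $\sigma_1,\dots,\sigma_m$ (each $\mathcal{A}-\sigma_j\mathcal{I}$ invertible): start with a QR decomposition $\mathcal{B}=V_1*H_{1,0}$. For $j=1,\dots,m$: set $\mathcal{W}=(\mathcal{A}-\sigma_j\mathcal{I})^{-1}*V_j$; for $i=1,\dots,j$ set $H_{i,j}=V_i^T*\mathcal{W}$ and replace $\mathcal{W}$ by $\mathcal{W}-V_i*H_{i,j}$; then compute a QR decomposition $\mathcal{W}=V_{j+1}*H_{j+1,j}$. Here a QR decomposition writes a tensor as $Q*R$ with $Q^T*Q$ the identity and $R\in\mathbb{R}^{K_1\times K_2\times K_1\times K_2}$ upper triangular (i.e. its matrix unfolding is upper triangular). The blocks produced satisfy $V_i^T*V_j=\mathcal{O}$ for $i\ne j$ and $V_i^T*V_i$ equal to the identity of size $K_1\times K_2\times K_1\times K_2$, for $1\le i,j\le m+1$. $\mathcal{H}_m\in\mathbb{R}^{K_1\times mK_2\times K_1\times mK_2}$ is the block upper Hessenberg tensor with $(i,j)$ block $H_{i,j}$ for $i\le j+1$ and zero block otherwise. *)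

theory Defs
  imports Complex_Main "Jordan_Normal_Form.Matrix"
begin

text \<open>A tensor carries its four mode sizes, in the same style as the matrices of
  \<^theory>\<open>Jordan_Normal_Form.Matrix\<close>. Indices start at 0. Entries outside the index
  range are normalized, so that two tensors are equal iff they have the same mode sizes and the
  same entries.\<close>

type_synonym quad = "nat \<times> nat \<times> nat \<times> nat"

definition in_range :: "quad \<Rightarrow> quad \<Rightarrow> bool" where
  "in_range = (\<lambda>(P1, P2, Q1, Q2) (p1, p2, q1, q2). p1 < P1 \<and> p2 < P2 \<and> q1 < Q1 \<and> q2 < Q2)"

lemma finite_in_range: "finite {i. in_range d i}"
proof -
  obtain P1 P2 Q1 Q2 where d: "d = (P1, P2, Q1, Q2)" by (cases d)
  have "{i. in_range d i} = {..<P1} \<times> {..<P2} \<times> {..<Q1} \<times> {..<Q2}"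
    by (auto simp: d in_range_def)
  then show ?thesis by simp
qed

typedef 'a tensor4 =
  "{(d, f) | d (f :: quad \<Rightarrow> 'a). \<forall>i. \<not> in_range d i \<longrightarrow> f i = undefined}"
  by (rule exI[of _ "((0, 0, 0, 0), \<lambda>_. undefined)"]) auto

setup_lifting type_definition_tensor4

lift_definition tdim :: "'a tensor4 \<Rightarrow> quad" is fst .

lift_definition tindex :: "'a tensor4 \<Rightarrow> quad \<Rightarrow> 'a" (infixl \<open>$\<^sub>t\<close> 100) is snd .

lift_definition tensor :: "quad \<Rightarrow> (quad \<Rightarrow> 'a) \<Rightarrow> 'a tensor4"
  is "\<lambda>d f. (d, \<lambda>i. if in_range d i then f i else undefined)" by auto

lemma tdim_tensor [simp]: "tdim (tensor d f) = d"
  by transfer simp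

lemma tindex_tensor [simp]: "in_range d i \<Longrightarrow> tensor d f $\<^sub>t i = f i"
  by transfer simp

lemma tensor_eqI:
  assumes "tdim X = tdim Y" and "\<And>i. in_range (tdim X) i \<Longrightarrow> X $\<^sub>t i = Y $\<^sub>t i"
  shows "X = Y"
  using assms by transfer (auto simp: fun_eq_iff, metis)

definition tensors :: "nat \<Rightarrow> nat \<Rightarrow> nat \<Rightarrow> nat \<Rightarrow> 'a tensor4 set" where
  "tensors P1 P2 Q1 Q2 = {X. tdim X = (P1, P2, Q1, Q2)}"

text \<open>The operation \<open>*\<close> is the Einstein product over two modes; it is only meaningful
  when the last two mode sizes of the left factor are the first two of the right factor.\<close>

instantiation tensor4 :: (semiring_0) times
begin
definition times_tensor4 :: "'a tensor4 \<Rightarrow> 'a tensor4 \<Rightarrow> 'a tensor4" where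
  "X * Y = (case (tdim X, tdim Y) of ((P1, P2, Q1, Q2), (_, _, R1, R2)) \<Rightarrow>
     tensor (P1, P2, R1, R2) (\<lambda>(p1, p2, r1, r2).
       \<Sum>q1<Q1. \<Sum>q2<Q2. X $\<^sub>t (p1, p2, q1, q2) * Y $\<^sub>t (q1, q2, r1, r2)))"
instance ..
end

instantiation tensor4 :: (minus) minus
begin
definition minus_tensor4 :: "'a tensor4 \<Rightarrow> 'a tensor4 \<Rightarrow> 'a tensor4" where
  "X - Y = tensor (tdim X) (\<lambda>i. X $\<^sub>t i - Y $\<^sub>t i)"
instance ..
end

definition smult_tensor :: "'a::times \<Rightarrow> 'a tensor4 \<Rightarrow> 'a tensor4" (infixl \<open>\<cdot>\<^sub>t\<close> 75) where
  "a \<cdot>\<^sub>t X = tensor (tdim X) (\<lambda>i. a * X $\<^sub>t i)"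

definition zero_tensor :: "nat \<Rightarrow> nat \<Rightarrow> nat \<Rightarrow> nat \<Rightarrow> 'a::zero tensor4" where
  "zero_tensor P1 P2 Q1 Q2 = tensor (P1, P2, Q1, Q2) (\<lambda>_. 0)"

definition id_tensor :: "nat \<Rightarrow> nat \<Rightarrow> 'a::zero_neq_one tensor4" where
  "id_tensor P1 P2 = tensor (P1, P2, P1, P2)
     (\<lambda>(p1, p2, q1, q2). if (p1, p2) = (q1, q2) then 1 else 0)"

definition transpose_tensor :: "'a tensor4 \<Rightarrow> 'a tensor4" (\<open>(_\<^sup>T)\<close> [1000] 1000) where
  "X\<^sup>T = (case tdim X of (P1, P2, Q1, Q2) \<Rightarrow>
     tensor (Q1, Q2, P1, P2) (\<lambda>(q1, q2, p1, p2). X $\<^sub>t (p1, p2, q1, q2)))"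

definition cplx :: "real tensor4 \<Rightarrow> complex tensor4" where
  "cplx X = tensor (tdim X) (\<lambda>i. complex_of_real (X $\<^sub>t i))"

definition frob_norm :: "'a::real_normed_vector tensor4 \<Rightarrow> real" where
  "frob_norm X = sqrt (\<Sum>i | in_range (tdim X) i. (norm (X $\<^sub>t i))\<^sup>2)"

definition inverse_pair :: "'a::ring_1 tensor4 \<Rightarrow> 'a tensor4 \<Rightarrow> bool" where
  "inverse_pair X Y \<longleftrightarrow> (\<exists>P1 P2. X \<in> tensors P1 P2 P1 P2 \<and> Y \<in> tensors P1 P2 P1 P2 \<and>
     X * Y = id_tensor P1 P2 \<and> Y * X = id_tensor P1 P2)"

definition invertible_tensor :: "'a::ring_1 tensor4 \<Rightarrow> bool" where
  "invertible_tensor X \<longleftrightarrow> (\<exists>Y. inverse_pair X Y)"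

text \<open>Unspecified unless the argument is invertible; two-sided inverses are unique.\<close>

definition inverse_tensor :: "'a::ring_1 tensor4 \<Rightarrow> 'a tensor4" where
  "inverse_tensor X = (SOME Y. inverse_pair X Y)"

text \<open>The unfolding merges the first two and the last two modes, each pair in column-major order
  (the first index of the pair runs fastest).\<close>

definition unfold_tensor :: "'a tensor4 \<Rightarrow> 'a mat" where
  "unfold_tensor X = (case tdim X of (P1, P2, Q1, Q2) \<Rightarrow>
     mat (P1 * P2) (Q1 * Q2) (\<lambda>(i, j). X $\<^sub>t (i mod P1, i div P1, j mod Q1, j div Q1)))"

definition qr_decomposition ::
  "nat \<Rightarrow> nat \<Rightarrow> nat \<Rightarrow> nat \<Rightarrow> real tensor4 \<Rightarrow> real tensor4 \<Rightarrow> real tensor4 \<Rightarrow> bool" where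
  "qr_decomposition P1 P2 K1 K2 X Q R \<longleftrightarrow>
     Q \<in> tensors P1 P2 K1 K2 \<and> R \<in> tensors K1 K2 K1 K2 \<and>
     X = Q * R \<and> Q\<^sup>T * Q = id_tensor K1 K2 \<and> upper_triangular (unfold_tensor R)"

text \<open>Blocks are numbered from 1, entries from 0: position \<open>c\<close> of a mode of size \<open>m * K2\<close> is
  position \<open>c mod K2\<close> of block number \<open>Suc (c div K2)\<close>.\<close>

definition block_concat ::
  "nat \<Rightarrow> nat \<Rightarrow> nat \<Rightarrow> nat \<Rightarrow> nat \<Rightarrow> (nat \<Rightarrow> 'a tensor4) \<Rightarrow> 'a tensor4" where
  "block_concat J1 J2 K1 K2 m V = tensor (J1, J2, K1, m * K2)
     (\<lambda>(j1, j2, k1, c). V (Suc (c div K2)) $\<^sub>t (j1, j2, k1, c mod K2))"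

definition block_square ::
  "nat \<Rightarrow> nat \<Rightarrow> nat \<Rightarrow> (nat \<Rightarrow> nat \<Rightarrow> 'a tensor4) \<Rightarrow> 'a tensor4" where
  "block_square K1 K2 m G = tensor (K1, m * K2, K1, m * K2)
     (\<lambda>(k1, r, l1, c). G (Suc (r div K2)) (Suc (c div K2)) $\<^sub>t (k1, r mod K2, l1, c mod K2))"

definition block_hessenberg ::
  "nat \<Rightarrow> nat \<Rightarrow> nat \<Rightarrow> (nat \<Rightarrow> nat \<Rightarrow> 'a::zero tensor4) \<Rightarrow> 'a tensor4" where
  "block_hessenberg K1 K2 m H =
     block_square K1 K2 m (\<lambda>i j. if i \<le> j + 1 then H i j else zero_tensor K1 K2 K1 K2)"

definition mode4_block :: "nat \<Rightarrow> nat \<Rightarrow> 'a tensor4 \<Rightarrow> 'a tensor4" where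
  "mode4_block K2 j X = (case tdim X of (P1, P2, Q1, _) \<Rightarrow>
     tensor (P1, P2, Q1, K2) (\<lambda>(p1, p2, q1, k2). X $\<^sub>t (p1, p2, q1, (j - 1) * K2 + k2)))"

text \<open>In step \<open>j\<close>, \<open>W i\<close> is the value of the work tensor after \<open>i\<close> passes through the inner
  (modified Gram--Schmidt) loop. The process is a relation because QR decompositions need not be
  unique.\<close>

definition rational_block_arnoldi ::
  "nat \<Rightarrow> nat \<Rightarrow> nat \<Rightarrow> nat \<Rightarrow> nat \<Rightarrow> real tensor4 \<Rightarrow> real tensor4 \<Rightarrow> (nat \<Rightarrow> real) \<Rightarrow>
   (nat \<Rightarrow> real tensor4) \<Rightarrow> (nat \<Rightarrow> nat \<Rightarrow> real tensor4) \<Rightarrow> bool" where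
  "rational_block_arnoldi J1 J2 K1 K2 m A B \<sigma> V H \<longleftrightarrow>
     qr_decomposition J1 J2 K1 K2 B (V 1) (H 1 0) \<and>
     (\<forall>j\<in>{1..m}. invertible_tensor (A - \<sigma> j \<cdot>\<^sub>t id_tensor J1 J2) \<and>
        (\<exists>W :: nat \<Rightarrow> real tensor4.
           W 0 = inverse_tensor (A - \<sigma> j \<cdot>\<^sub>t id_tensor J1 J2) * V j \<and>
           (\<forall>i\<in>{1..j}. H i j = (V i)\<^sup>T * W (i - 1) \<and> W i = W (i - 1) - V i * H i j) \<and>
           qr_decomposition J1 J2 K1 K2 (W j) (V (j + 1)) (H (j + 1) j)))"

text \<open>Orthonormality of the blocks is stated separately: when the work tensor is rank deficient,
  the defining equations of a QR decomposition alone do not force the new block to be orthogonal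
  to the previous ones.\<close>

definition orthonormal_blocks ::
  "nat \<Rightarrow> nat \<Rightarrow> nat \<Rightarrow> (nat \<Rightarrow> real tensor4) \<Rightarrow> bool" where
  "orthonormal_blocks K1 K2 n V \<longleftrightarrow> (\<forall>i\<in>{1..n}. \<forall>j\<in>{1..n}.
     (V i)\<^sup>T * V j = (if i = j then id_tensor K1 K2 else zero_tensor K1 K2 K1 K2))"

end

theory Submission
  imports Defs "HOL-Analysis.L2_Norm"
begin

text \<open>Let \<open>Q = I - \<V>\<^sub>m \<V>\<^sub>m\<^sup>T\<close>, the orthogonal projection that kills \<open>V\<^sub>1, \<dots>, V\<^sub>m\<close> and hence
  \<open>B\<close>. Put \<open>W\<^sub>j = (A - \<sigma>\<^sub>j I)\<inverse> V\<^sub>j\<close>. Then \<open>Q A W\<^sub>j = Q V\<^sub>j + \<sigma>\<^sub>j Q W\<^sub>j = 0\<close>: for \<open>j < m\<close> because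
  \<open>W\<^sub>j\<close> is a combination of \<open>V\<^sub>1, \<dots>, V\<^sub>m\<close>, and for \<open>j = m\<close> because \<open>\<sigma>\<^sub>m = 0\<close>. The process says that
  the concatenation of the \<open>W\<^sub>j\<close> is \<open>\<V>\<^sub>m \<H>\<^sub>m + V\<^bsub>m+1\<^esub> H\<^bsub>m+1,m\<^esub> E\<^sub>m\<^sup>T\<close>, so \<open>Q A \<V>\<^sub>m = - Q G\<close> with
  \<open>G = A V\<^bsub>m+1\<^esub> H\<^bsub>m+1,m\<^esub> E\<^sub>m\<^sup>T \<H>\<^sub>m\<inverse>\<close>.

  Let \<open>X = (s I\<^sub>m - A\<^sub>m)\<inverse> B\<^sub>m\<close>, and let \<open>Y = B - (s I - A) \<V>\<^sub>m X\<close> be the residual. It satisfies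
  \<open>\<V>\<^sub>m\<^sup>T Y = 0\<close>, so \<open>Y = Q Y = - Q G X\<close> and \<open>Y\<close> is no longer than \<open>G X\<close>. Finally
  \<open>F(s) - F\<^sub>m(s) = C (s I - A)\<inverse> Y\<close>, and the Frobenius norm is submultiplicative.\<close>

section \<open>Tensors as matrices over pairs of indices\<close>

text \<open>Indices stay pairs instead of being flattened to numbers: a tensor is read as a matrix
  over pairs, and the Einstein product becomes a matrix product over one finite index set.\<close>

definition index_set :: "nat \<times> nat \<Rightarrow> (nat \<times> nat) set" where
  "index_set d = {..<fst d} \<times> {..<snd d}"

definition rdim :: "'a tensor4 \<Rightarrow> nat \<times> nat" where
  "rdim X = (fst (tdim X), fst (snd (tdim X)))"

definition cdim :: "'a tensor4 \<Rightarrow> nat \<times> nat" where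
  "cdim X = snd (snd (tdim X))"

definition ent :: "'a tensor4 \<Rightarrow> nat \<times> nat \<Rightarrow> nat \<times> nat \<Rightarrow> 'a" where
  "ent X p q = X $\<^sub>t (fst p, snd p, q)"

lemma finite_index_set [simp]: "finite (index_set d)"
  by (simp add: index_set_def)

lemma tensor_ext:
  assumes "rdim X = rdim Y" "cdim X = cdim Y"
    and "\<And>p q. p \<in> index_set (rdim X) \<Longrightarrow> q \<in> index_set (cdim X) \<Longrightarrow> ent X p q = ent Y p q"
  shows "X = Y"
proof (rule tensor_eqI)
  show d: "tdim X = tdim Y"
    using assms(1,2) by (simp add: rdim_def cdim_def prod_eq_iff)
  fix i assume "in_range (tdim X) i"
  then show "X $\<^sub>t i = Y $\<^sub>t i"
    using assms(3)[of "(fst i, fst (snd i))" "snd (snd i)"]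
    by (cases i) (auto simp: in_range_def index_set_def rdim_def cdim_def ent_def split: prod.splits)
qed

lemma tensors_iff: "X \<in> tensors P1 P2 Q1 Q2 \<longleftrightarrow> rdim X = (P1, P2) \<and> cdim X = (Q1, Q2)"
  by (cases "tdim X") (auto simp: tensors_def rdim_def cdim_def)

section \<open>Sizes and entries of the tensor operations\<close>

lemma dim_tensor [simp]:
  "rdim (tensor d f) = (fst d, fst (snd d))" "cdim (tensor d f) = snd (snd d)"
  by (simp_all add: rdim_def cdim_def)

lemma ent_tensor:
  "p \<in> index_set (fst d, fst (snd d)) \<Longrightarrow> q \<in> index_set (snd (snd d)) \<Longrightarrow>
    ent (tensor d f) p q = f (fst p, snd p, q)"
  by (cases d) (auto simp: ent_def index_set_def in_range_def)

lemma dim_times [simp]: "rdim (X * Y) = rdim X" "cdim (X * Y) = cdim Y"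
  by (cases "tdim X"; cases "tdim Y"; simp add: times_tensor4_def rdim_def cdim_def)+

lemma dim_minus [simp]: "rdim (X - Y) = rdim X" "cdim (X - Y) = cdim X"
  by (simp_all add: minus_tensor4_def rdim_def cdim_def)

lemma dim_smult [simp]: "rdim (a \<cdot>\<^sub>t X) = rdim X" "cdim (a \<cdot>\<^sub>t X) = cdim X"
  by (simp_all add: smult_tensor_def rdim_def cdim_def)

lemma dim_zero [simp]:
  "rdim (zero_tensor P1 P2 Q1 Q2) = (P1, P2)" "cdim (zero_tensor P1 P2 Q1 Q2) = (Q1, Q2)"
  by (simp_all add: zero_tensor_def)

lemma dim_id [simp]: "rdim (id_tensor P1 P2) = (P1, P2)" "cdim (id_tensor P1 P2) = (P1, P2)"
  by (simp_all add: id_tensor_def)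

lemma dim_transpose [simp]: "rdim (X\<^sup>T) = cdim X" "cdim (X\<^sup>T) = rdim X"
  by (cases "tdim X"; simp add: transpose_tensor_def rdim_def cdim_def)+

lemma dim_cplx [simp]: "rdim (cplx X) = rdim X" "cdim (cplx X) = cdim X"
  by (simp_all add: cplx_def rdim_def cdim_def)

lemma dim_block_concat [simp]:
  "rdim (block_concat J1 J2 K1 K2 m V) = (J1, J2)"
  "cdim (block_concat J1 J2 K1 K2 m V) = (K1, m * K2)"
  by (simp_all add: block_concat_def)

lemma dim_block_hessenberg [simp]:
  "rdim (block_hessenberg K1 K2 m H) = (K1, m * K2)"
  "cdim (block_hessenberg K1 K2 m H) = (K1, m * K2)"
  by (simp_all add: block_hessenberg_def block_square_def)

lemma dim_mode4_block [simp]: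
  "rdim (mode4_block K2 j X) = rdim X" "cdim (mode4_block K2 j X) = (fst (cdim X), K2)"
  by (cases "tdim X"; simp add: mode4_block_def rdim_def cdim_def)+

text \<open>The double sum becomes one sum over pairs. As a simp rule this unfolds every product,
  hence the later \<open>del: ent_times\<close> where a product must stay whole.\<close>

lemma ent_times [simp]:
  "p \<in> index_set (rdim X) \<Longrightarrow> r \<in> index_set (cdim Y) \<Longrightarrow>
    ent (X * Y) p r = (\<Sum>q\<in>index_set (cdim X). ent X p q * ent Y q r)"
  by (cases "tdim X"; cases "tdim Y"; cases r)
     (simp add: times_tensor4_def ent_tensor rdim_def cdim_def sum.cartesian_product index_set_def,
      simp add: ent_def split_def)

lemma ent_minus [simp]:
  "p \<in> index_set (rdim X) \<Longrightarrow> q \<in> index_set (cdim X) \<Longrightarrow> ent (X - Y) p q = ent X p q - ent Y p q"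
  by (simp add: minus_tensor4_def ent_tensor rdim_def cdim_def) (simp add: ent_def)

lemma ent_smult [simp]:
  "p \<in> index_set (rdim X) \<Longrightarrow> q \<in> index_set (cdim X) \<Longrightarrow> ent (a \<cdot>\<^sub>t X) p q = a * ent X p q"
  by (simp add: smult_tensor_def ent_tensor rdim_def cdim_def) (simp add: ent_def)

lemma ent_zero [simp]:
  "p \<in> index_set (P1, P2) \<Longrightarrow> q \<in> index_set (Q1, Q2) \<Longrightarrow> ent (zero_tensor P1 P2 Q1 Q2) p q = 0"
  by (simp add: zero_tensor_def ent_tensor)

lemma ent_id [simp]:
  "p \<in> index_set (P1, P2) \<Longrightarrow> q \<in> index_set (P1, P2) \<Longrightarrow>
    ent (id_tensor P1 P2) p q = (if p = q then 1 else 0)"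
  by (cases p; cases q) (simp add: id_tensor_def ent_tensor)

lemma ent_transpose [simp]:
  "p \<in> index_set (cdim X) \<Longrightarrow> q \<in> index_set (rdim X) \<Longrightarrow> ent (X\<^sup>T) p q = ent X q p"
  by (cases "tdim X"; cases q)
     (simp add: transpose_tensor_def ent_tensor rdim_def cdim_def, simp add: ent_def)

lemma ent_cplx [simp]:
  "p \<in> index_set (rdim X) \<Longrightarrow> q \<in> index_set (cdim X) \<Longrightarrow> ent (cplx X) p q = complex_of_real (ent X p q)"
  by (simp add: cplx_def ent_tensor rdim_def cdim_def) (simp add: ent_def)

lemma ent_block_concat:
  "p \<in> index_set (J1, J2) \<Longrightarrow> k < K1 \<Longrightarrow> c < m * K2 \<Longrightarrow>
    ent (block_concat J1 J2 K1 K2 m V) p (k, c) = ent (V (Suc (c div K2))) p (k, c mod K2)"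
  by (subst block_concat_def, subst ent_tensor) (auto simp: index_set_def ent_def)

text \<open>Blocks are numbered from 1 but quotients start at 0, so the Hessenberg condition
  \<open>i \<le> j + 1\<close> turns into \<open>r div K2 \<le> Suc (c div K2)\<close>.\<close>

lemma ent_block_hessenberg:
  "k < K1 \<Longrightarrow> r < m * K2 \<Longrightarrow> l < K1 \<Longrightarrow> c < m * K2 \<Longrightarrow>
    ent (block_hessenberg K1 K2 m H) (k, r) (l, c) =
      (if r div K2 \<le> Suc (c div K2)
       then ent (H (Suc (r div K2)) (Suc (c div K2))) (k, r mod K2) (l, c mod K2) else 0)"
proof -
  assume a: "k < K1" "r < m * K2" "l < K1" "c < m * K2"
  \<comment> \<open>A row \<open>r < m * K2\<close> exists only if \<open>K2 > 0\<close>. Remainders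
    modulo \<open>K2\<close> are then in range, where a zero block has the value 0 and not
    \<open>undefined\<close>.\<close>
  then have K2: "K2 > 0" by (cases K2) auto
  show ?thesis
    unfolding block_hessenberg_def block_square_def
    by (subst ent_tensor)
       (use a K2 in \<open>auto simp: index_set_def ent_def zero_tensor_def in_range_def\<close>)
qed

lemma ent_mode4_block:
  "p \<in> index_set (rdim X) \<Longrightarrow> k < fst (cdim X) \<Longrightarrow> c < K2 \<Longrightarrow>
    ent (mode4_block K2 j X) p (k, c) = ent X p (k, (j - 1) * K2 + c)"
  by (cases "tdim X")
     (auto simp: mode4_block_def ent_tensor index_set_def rdim_def cdim_def, simp add: ent_def)

section \<open>Algebra of the Einstein product\<close>

text \<open>The product sums over the column indices of its left factor and may read
  \<open>undefined\<close> entries of a right factor of another size; hence the size conditions on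
  the laws in this section.\<close>

lemma tensor_assoc:
  fixes X Y Z :: "'a::semiring_0 tensor4"
  assumes "cdim X = rdim Y" "cdim Y = rdim Z"
  shows "(X * Y) * Z = X * (Y * Z)"
proof (rule tensor_ext)
  fix p r
  assume "p \<in> index_set (rdim (X * Y * Z))" "r \<in> index_set (cdim (X * Y * Z))"
  then show "ent (X * Y * Z) p r = ent (X * (Y * Z)) p r"
    using assms sum.swap[of "\<lambda>i j. ent X p j * (ent Y j i * ent Z i r)" "index_set (rdim Y)" "index_set (rdim Z)"]
    by (simp add: sum_distrib_left sum_distrib_right mult.assoc)
qed simp_all

lemma tensor_mult_minus:
  fixes X Y Z :: "'a::ring tensor4"
  assumes "cdim X = rdim Y" "rdim Y = rdim Z" "cdim Y = cdim Z"
  shows "X * (Y - Z) = X * Y - X * Z"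
  by (rule tensor_ext) (use assms in \<open>simp_all add: sum_subtractf right_diff_distrib\<close>)

lemma tensor_minus_mult:
  fixes X Y Z :: "'a::ring tensor4"
  assumes "cdim X = rdim Z" "rdim Y = rdim X" "cdim Y = cdim X"
  shows "(X - Y) * Z = X * Z - Y * Z"
  by (rule tensor_ext) (use assms in \<open>simp_all add: sum_subtractf left_diff_distrib\<close>)

lemma tensor_smult_mult:
  fixes X Y :: "'a::semiring_0 tensor4"
  assumes "cdim X = rdim Y"
  shows "(a \<cdot>\<^sub>t X) * Y = a \<cdot>\<^sub>t (X * Y)"
  by (rule tensor_ext) (use assms in \<open>simp_all add: sum_distrib_left mult.assoc\<close>)

lemma tensor_mult_smult:
  fixes X Y :: "'a::comm_semiring_0 tensor4"
  assumes "cdim X = rdim Y"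
  shows "X * (a \<cdot>\<^sub>t Y) = a \<cdot>\<^sub>t (X * Y)"
  by (rule tensor_ext) (use assms in \<open>simp_all add: sum_distrib_left mult.left_commute\<close>)

lemma tensor_id_mult:
  fixes X :: "'a::ring_1 tensor4"
  assumes "rdim X = (P1, P2)"
  shows "id_tensor P1 P2 * X = X"
  by (rule tensor_ext)
     (use assms in \<open>simp_all add: if_distrib[of "\<lambda>x. x * _"] cong: if_cong\<close>)

lemma tensor_mult_id:
  fixes X :: "'a::ring_1 tensor4"
  assumes "cdim X = (P1, P2)"
  shows "X * id_tensor P1 P2 = X"
  by (rule tensor_ext)
     (use assms in \<open>simp_all add: if_distrib[of "\<lambda>x. _ * x"] cong: if_cong\<close>)

lemma tensor_zero_mult:
  fixes X :: "'a::semiring_0 tensor4"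
  assumes "rdim X = (Q1, Q2)" "cdim X = (R1, R2)"
  shows "zero_tensor P1 P2 Q1 Q2 * X = zero_tensor P1 P2 R1 R2"
  by (rule tensor_ext) (use assms in simp_all)

lemma tensor_mult_zero:
  fixes X :: "'a::semiring_0 tensor4"
  assumes "rdim X = (P1, P2)" "cdim X = (Q1, Q2)"
  shows "X * zero_tensor Q1 Q2 R1 R2 = zero_tensor P1 P2 R1 R2"
  by (rule tensor_ext) (use assms in simp_all)

lemma tensor_minus_zero:
  fixes X :: "'a::ring tensor4"
  assumes "rdim X = (P1, P2)" "cdim X = (Q1, Q2)"
  shows "X - zero_tensor P1 P2 Q1 Q2 = X"
  by (rule tensor_ext) (use assms in simp_all)

lemma tensor_minus_self:
  fixes X :: "'a::ring tensor4"
  assumes "rdim X = (P1, P2)" "cdim X = (Q1, Q2)"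
  shows "X - X = zero_tensor P1 P2 Q1 Q2"
  by (rule tensor_ext) (use assms in simp_all)

lemma tensor_smult_zero: "a \<cdot>\<^sub>t zero_tensor P1 P2 Q1 Q2 = (zero_tensor P1 P2 Q1 Q2 :: 'a::semiring_0 tensor4)"
  by (rule tensor_ext) simp_all

lemma tensor_zero_smult:
  fixes X :: "'a::semiring_0 tensor4"
  assumes "rdim X = (P1, P2)" "cdim X = (Q1, Q2)"
  shows "0 \<cdot>\<^sub>t X = zero_tensor P1 P2 Q1 Q2"
  by (rule tensor_ext) (use assms in simp_all)

section \<open>Transfer from real to complex tensors\<close>

lemma cplx_times: "cdim X = rdim Y \<Longrightarrow> cplx (X * Y) = cplx X * cplx Y"
  by (rule tensor_ext) simp_all

lemma cplx_minus: "rdim X = rdim Y \<Longrightarrow> cdim X = cdim Y \<Longrightarrow> cplx (X - Y) = cplx X - cplx Y"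
  by (rule tensor_ext) simp_all

lemma cplx_id: "cplx (id_tensor P1 P2) = id_tensor P1 P2"
  by (rule tensor_ext) simp_all

lemma cplx_zero: "cplx (zero_tensor P1 P2 Q1 Q2) = zero_tensor P1 P2 Q1 Q2"
  by (rule tensor_ext) simp_all

lemma cplx_transpose: "cplx (X\<^sup>T) = (cplx X)\<^sup>T"
  by (rule tensor_ext) simp_all

section \<open>Block tensors\<close>

text \<open>A column of a product depends only on the same column of the right factor, so selecting
  columns commutes with left multiplication.\<close>

lemma mode4_block_times:
  fixes X Y :: "'a::semiring_0 tensor4"
  assumes "cdim X = rdim Y" "cdim Y = (K1, m * K2)" "j \<in> {1..m}"
  shows "mode4_block K2 j (X * Y) = X * mode4_block K2 j Y"
proof (rule tensor_ext)
  fix p q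
  assume "p \<in> index_set (rdim (mode4_block K2 j (X * Y)))" "q \<in> index_set (cdim (mode4_block K2 j (X * Y)))"
  then obtain k c where q: "q = (k, c)" "k < K1" "c < K2" and p: "p \<in> index_set (rdim X)"
    using assms by (auto simp: index_set_def)
  \<comment> \<open>Since \<open>j \<ge> 1\<close>, block \<open>j\<close> ends at
    \<open>Suc (j - 1) * K2 = j * K2\<close>, which is within the \<open>m * K2\<close>
    columns.\<close>
  have "(j - 1) * K2 + c < Suc (j - 1) * K2" using q by simp
  also have "\<dots> \<le> m * K2" using assms(3) by (intro mult_le_mono1) auto
  finally have "(k, (j - 1) * K2 + c) \<in> index_set (cdim Y)"
    using assms q by (auto simp: index_set_def)
  then show "ent (mode4_block K2 j (X * Y)) p q = ent (X * mode4_block K2 j Y) p q"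
    using p q assms by (subst ent_times) (auto simp: ent_mode4_block, auto simp: index_set_def)
qed simp_all

text \<open>With \<open>mode4_block_times\<close>, this carries an identity for the concatenation
  over to each single block.\<close>

lemma mode4_block_concat:
  assumes "j \<in> {1..m}" "rdim (V j) = (J1, J2)" "cdim (V j) = (K1, K2)"
  shows "mode4_block K2 j (block_concat J1 J2 K1 K2 m V) = V j"
proof (rule tensor_ext)
  fix p q
  assume a: "p \<in> index_set (rdim (mode4_block K2 j (block_concat J1 J2 K1 K2 m V)))"
    "q \<in> index_set (cdim (mode4_block K2 j (block_concat J1 J2 K1 K2 m V)))"
  then obtain k c where q: "q = (k, c)" "k < K1" "c < K2" by (auto simp: index_set_def)
  have "(j - 1) * K2 + c < Suc (j - 1) * K2" using q by simp
  also have "\<dots> \<le> m * K2" using assms(1) by (intro mult_le_mono1) auto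
  finally show "ent (mode4_block K2 j (block_concat J1 J2 K1 K2 m V)) p q = ent (V j) p q"
    using a q assms by (simp add: ent_mode4_block ent_block_concat)
qed (use assms in simp_all)

text \<open>The passage from the blocks back to the concatenation: each column of the product is a
  column of some \<open>X * V j\<close>.\<close>

lemma times_block_concat_eq_zero:
  fixes X :: "'a::semiring_0 tensor4"
  assumes "rdim X = (P1, P2)" "cdim X = (J1, J2)"
    and V: "\<And>j. j \<in> {1..m} \<Longrightarrow> rdim (V j) = (J1, J2) \<and> cdim (V j) = (K1, K2)"
    and zero: "\<And>j. j \<in> {1..m} \<Longrightarrow> X * V j = zero_tensor P1 P2 K1 K2"
  shows "X * block_concat J1 J2 K1 K2 m V = zero_tensor P1 P2 K1 (m * K2)"
proof (rule tensor_ext)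
  let ?V = "block_concat J1 J2 K1 K2 m V"
  fix p q
  assume a: "p \<in> index_set (rdim (X * ?V))" "q \<in> index_set (cdim (X * ?V))"
  then obtain k c where q: "q = (k, c)" "k < K1" "c < m * K2" by (auto simp: index_set_def)
  then have K2: "K2 > 0" by (cases K2) auto
  let ?j = "Suc (c div K2)"
  have j: "?j \<in> {1..m}" using q K2 by (simp add: Suc_le_eq less_mult_imp_div_less)
  have "ent (X * ?V) p q = ent (X * V ?j) p (k, c mod K2)"
    using a q assms(1,2) V[OF j] K2 by (simp add: ent_block_concat) (simp add: index_set_def)
  also have "\<dots> = ent (zero_tensor P1 P2 K1 (m * K2)) p q"
    using a q assms(1,2) K2 by (simp add: zero[OF j]) (simp add: index_set_def)
  finally show "ent (X * ?V) p q = ent (zero_tensor P1 P2 K1 (m * K2)) p q" .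
qed (use assms in simp_all)

text \<open>Each entry of the Gram tensor of the concatenation is an entry of some
  \<open>(V i)\<^sup>T * V j\<close>. The bound \<open>n\<close> allows for the extra block
  \<open>V (m + 1)\<close>.\<close>

lemma block_concat_orthonormal:
  fixes V :: "nat \<Rightarrow> real tensor4"
  assumes "\<And>j. j \<in> {1..m} \<Longrightarrow> rdim (V j) = (J1, J2) \<and> cdim (V j) = (K1, K2)"
    and "orthonormal_blocks K1 K2 n V" "m \<le> n"
  shows "(block_concat J1 J2 K1 K2 m V)\<^sup>T * block_concat J1 J2 K1 K2 m V = id_tensor K1 (m * K2)"
proof (rule tensor_ext)
  fix p q
  let ?V = "block_concat J1 J2 K1 K2 m V"
  assume a: "p \<in> index_set (rdim (?V\<^sup>T * ?V))" "q \<in> index_set (cdim (?V\<^sup>T * ?V))"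
  then obtain k r l c where q: "p = (k, r)" "k < K1" "r < m * K2" "q = (l, c)" "l < K1" "c < m * K2"
    by (auto simp: index_set_def)
  then have K2: "K2 > 0" by (cases K2) auto
  let ?i = "Suc (r div K2)" and ?j = "Suc (c div K2)"
  have ij: "?i \<in> {1..m}" "?j \<in> {1..m}"
    using q K2 by (simp_all add: Suc_le_eq less_mult_imp_div_less)
  have "ent (?V\<^sup>T * ?V) p q = (\<Sum>x\<in>index_set (J1, J2). ent (V ?i) x (k, r mod K2) * ent (V ?j) x (l, c mod K2))"
    using a q by (simp add: ent_block_concat)
  also have "\<dots> = ent ((V ?i)\<^sup>T * V ?j) (k, r mod K2) (l, c mod K2)"
    using q K2 assms(1)[OF ij(1)] assms(1)[OF ij(2)] by (simp add: index_set_def)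
  also have "(V ?i)\<^sup>T * V ?j = (if ?i = ?j then id_tensor K1 K2 else zero_tensor K1 K2 K1 K2)"
    using assms(2,3) ij by (auto simp: orthonormal_blocks_def)
  \<comment> \<open>Quotient and remainder modulo \<open>K2\<close> together determine the position,
    so equal blocks and equal offsets mean \<open>r = c\<close>.\<close>
  also have "ent \<dots> (k, r mod K2) (l, c mod K2) = (if k = l \<and> r = c then 1 else 0)"
    using q K2 by (auto simp: index_set_def) (metis div_mult_mod_eq)
  also have "\<dots> = ent (id_tensor K1 (m * K2)) p q"
    using q by (simp add: index_set_def)
  finally show "ent (?V\<^sup>T * ?V) p q = ent (id_tensor K1 (m * K2)) p q" .
qed simp_all

text \<open>Division with remainder by \<open>K2\<close> is the bijection between positions and
  pairs of block and offset. For \<open>K2 = 0\<close> both sides are 0.\<close>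

lemma sum_box_blocks:
  "(\<Sum>x\<in>index_set (K1, m * K2). g x) = (\<Sum>i<m. \<Sum>y\<in>index_set (K1, K2). g (fst y, i * K2 + snd y))"
proof -
  have lt: "i * K2 + b < m * K2" if "i < m" "b < K2" for i b
  proof -
    have "i * K2 + b < Suc i * K2" using that by simp
    also have "\<dots> \<le> m * K2" using that by (intro mult_le_mono1) auto
    finally show ?thesis .
  qed
  show ?thesis
    unfolding sum.cartesian_product
    by (rule sum.reindex_bij_witness[where i = "\<lambda>z. (fst (snd z), fst z * K2 + snd (snd z))"
          and j = "\<lambda>x. (snd x div K2, fst x, snd x mod K2)"])
       (auto simp: index_set_def lt less_mult_imp_div_less intro!: mod_less_divisor Nat.gr0I)
qed

text \<open>A row of the last block column of the identity contains at most a single 1, so the sum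
  over the inner index collapses to one term.\<close>

lemma ent_times_last_block:
  fixes X :: "real tensor4"
  assumes "p \<in> index_set (rdim X)" "cdim X = (K1, K2)" "l < K1" "c < m * K2"
  shows "ent (X * (mode4_block K2 m (id_tensor K1 (m * K2)))\<^sup>T) p (l, c) =
    (if Suc (c div K2) = m then ent X p (l, c mod K2) else 0)"
proof -
  let ?E = "mode4_block K2 m (id_tensor K1 (m * K2)) :: real tensor4"
  from assms have K2: "K2 > 0" and m: "m > 0" by (cases K2; cases m; auto)+
  have E: "ent ?E (l, c) y = (if Suc (c div K2) = m \<and> y = (l, c mod K2) then 1 else 0)"
    if y_in: "y \<in> index_set (K1, K2)" for y
  proof -
    obtain k b where y: "y = (k, b)" "k < K1" "b < K2" using y_in by (auto simp: index_set_def)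
    have "(m - 1) * K2 + b < Suc (m - 1) * K2" using y by simp
    then have lt: "(m - 1) * K2 + b < m * K2" using m by simp
    \<comment> \<open>Uniqueness of division with remainder: \<open>m - 1\<close> is the quotient
      and \<open>b\<close> the remainder of \<open>c\<close>.\<close>
    have "c = (m - 1) * K2 + b \<longleftrightarrow> Suc (c div K2) = m \<and> b = c mod K2"
      using y m div_mult_mod_eq[of c K2] by auto
    then show ?thesis
      using assms y lt by (auto simp: ent_mode4_block index_set_def)
  qed
  have "ent (X * ?E\<^sup>T) p (l, c) = (\<Sum>y\<in>index_set (K1, K2). ent X p y * ent ?E (l, c) y)"
    using assms by (auto simp: index_set_def)
  also have "\<dots> = (\<Sum>y\<in>index_set (K1, K2). if y = (l, c mod K2) then
      (if Suc (c div K2) = m then ent X p y else 0) else 0)"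
    by (rule sum.cong) (auto simp: E)
  also have "\<dots> = (if Suc (c div K2) = m then ent X p (l, c mod K2) else 0)"
    using assms K2 by (simp add: index_set_def)
  finally show ?thesis .
qed

text \<open>The Arnoldi relation. The expansion of \<open>W j\<close> uses the blocks 1 to
  \<open>j + 1\<close>, whereas the concatenation has only \<open>m\<close>. Just for
  \<open>j = m\<close> one term, that of \<open>V (m + 1)\<close>, is left over, and the factor
  \<open>E_m\<close> transposed puts it into the last block of columns.\<close>

lemma block_concat_hessenberg:
  fixes V W :: "nat \<Rightarrow> real tensor4" and H :: "nat \<Rightarrow> nat \<Rightarrow> real tensor4"
  assumes V: "\<And>i. i \<in> {1..m+1} \<Longrightarrow> rdim (V i) = (J1, J2) \<and> cdim (V i) = (K1, K2)"
    and H: "\<And>i j. j \<in> {1..m} \<Longrightarrow> i \<in> {1..j+1} \<Longrightarrow> rdim (H i j) = (K1, K2) \<and> cdim (H i j) = (K1, K2)"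
    and W: "\<And>j p q. j \<in> {1..m} \<Longrightarrow> p \<in> index_set (J1, J2) \<Longrightarrow> q \<in> index_set (K1, K2) \<Longrightarrow>
      ent (W j) p q = (\<Sum>i\<le>j. ent (V (Suc i) * H (Suc i) j) p q)"
    and m: "m \<ge> 1"
  shows "block_concat J1 J2 K1 K2 m V * block_hessenberg K1 K2 m H =
    block_concat J1 J2 K1 K2 m W
      - V (m + 1) * H (m + 1) m * (mode4_block K2 m (id_tensor K1 (m * K2)))\<^sup>T"
proof (rule tensor_ext)
  let ?V = "block_concat J1 J2 K1 K2 m V" and ?H = "block_hessenberg K1 K2 m H"
    and ?W = "block_concat J1 J2 K1 K2 m W" and ?Y = "V (m + 1) * H (m + 1) m"
    and ?E = "mode4_block K2 m (id_tensor K1 (m * K2)) :: real tensor4"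
  fix p q
  assume "p \<in> index_set (rdim (?V * ?H))" "q \<in> index_set (cdim (?V * ?H))"
  then obtain l c where p: "p \<in> index_set (J1, J2)" and q: "q = (l, c)" "l < K1" "c < m * K2"
    by (auto simp: index_set_def)
  then have K2: "K2 > 0" by (cases K2) auto
  let ?j = "Suc (c div K2)" and ?c = "c mod K2"
  have j: "?j \<in> {1..m}" using q K2 by (simp add: Suc_le_eq less_mult_imp_div_less)
  have lc: "(l, ?c) \<in> index_set (K1, K2)" using q K2 by (simp add: index_set_def)
  \<comment> \<open>\<open>f i\<close> is the contribution of block \<open>Suc i\<close> to the
    entry at row \<open>p\<close> in column \<open>c\<close>.\<close>
  define f where "f = (\<lambda>i. ent (V (Suc i) * H (Suc i) ?j) p (l, ?c))"
  have f: "f i = (\<Sum>y\<in>index_set (K1, K2). ent (V (Suc i)) p y * ent (H (Suc i) ?j) y (l, ?c))"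
    if "i \<le> ?j" for i
    using V[of "Suc i"] H[OF j, of "Suc i"] that j p lc by (simp add: f_def)
  have block: "(\<Sum>y\<in>index_set (K1, K2). ent ?V p (fst y, i * K2 + snd y) * ent ?H (fst y, i * K2 + snd y) q)
      = (if i \<le> ?j then f i else 0)" if "i < m" for i
  proof -
    have lt: "i * K2 + b < m * K2" if "b < K2" for b
    proof -
      have "i * K2 + b < Suc i * K2" using that by simp
      also have "\<dots> \<le> m * K2" using \<open>i < m\<close> by (intro mult_le_mono1) auto
      finally show ?thesis .
    qed
    have "(\<Sum>y\<in>index_set (K1, K2). ent ?V p (fst y, i * K2 + snd y) * ent ?H (fst y, i * K2 + snd y) q)
      = (\<Sum>y\<in>index_set (K1, K2). ent (V (Suc i)) p y * (if i \<le> ?j then ent (H (Suc i) ?j) y (l, ?c) else 0))"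
      by (rule sum.cong) (use p q lt in \<open>auto simp: index_set_def ent_block_concat ent_block_hessenberg\<close>)
    then show ?thesis using f by simp
  qed
  have "ent (?V * ?H) p q = (\<Sum>x\<in>index_set (K1, m * K2). ent ?V p x * ent ?H x q)"
    using p q by (simp add: index_set_def)
  also have "\<dots> = (\<Sum>i<m. if i \<le> ?j then f i else 0)"
    by (simp only: sum_box_blocks) (rule sum.cong, use block in auto)
  also have "\<dots> = (\<Sum>i\<in>{i\<in>{..<m}. i \<le> ?j}. f i)"
    by (rule sum.inter_filter[symmetric]) simp
  \<comment> \<open>As \<open>?j \<le> m\<close>, the restriction \<open>i < m\<close> removes a
    term only when \<open>?j = m\<close>, namely \<open>f m\<close>.\<close>
  also have "\<dots> = (\<Sum>i\<le>?j. f i) - (if ?j = m then f m else 0)"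
  proof (cases "?j = m")
    case True
    then have "{i\<in>{..<m}. i \<le> ?j} = {..<m}" "{..?j} = insert m {..<m}" by auto
    with True show ?thesis by simp
  next
    case False
    with j have "{i\<in>{..<m}. i \<le> ?j} = {..?j}" by auto
    with False show ?thesis by simp
  qed
  also have "(\<Sum>i\<le>?j. f i) = ent ?W p q"
    using W[OF j p lc] p q by (simp add: f_def ent_block_concat)
  also have "(if ?j = m then f m else 0) = ent (?Y * ?E\<^sup>T) p q"
    using ent_times_last_block[of p ?Y K1 K2 l c m] V[of "m + 1"] H[of m "m + 1"] m p q
    by (simp add: f_def)
  finally show "ent (?V * ?H) p q = ent (?W - ?Y * ?E\<^sup>T) p q"
    using p q by (simp add: index_set_def)
qed (use V[of "m + 1"] in simp_all)

section \<open>Inverses and the Frobenius norm\<close>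

text \<open>\<open>inverse_pair\<close> hides the sizes behind an existential; the row size of
  \<open>X\<close> determines them.\<close>

lemma inverse_tensor:
  assumes "invertible_tensor X" "rdim X = (P1, P2)"
  shows "X * inverse_tensor X = id_tensor P1 P2" "inverse_tensor X * X = id_tensor P1 P2"
    "rdim (inverse_tensor X) = (P1, P2)" "cdim (inverse_tensor X) = (P1, P2)"
proof -
  have "inverse_pair X (inverse_tensor X)"
    using assms(1) unfolding invertible_tensor_def inverse_tensor_def by (rule someI_ex)
  then show "X * inverse_tensor X = id_tensor P1 P2" "inverse_tensor X * X = id_tensor P1 P2"
    "rdim (inverse_tensor X) = (P1, P2)" "cdim (inverse_tensor X) = (P1, P2)"
    using assms(2) by (auto simp: inverse_pair_def tensors_iff)
qed

text \<open>Columns are summed outermost so that norms can be compared column by column.\<close>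

lemma frob_norm_ent:
  "frob_norm X = sqrt (\<Sum>q\<in>index_set (cdim X). \<Sum>p\<in>index_set (rdim X). (norm (ent X p q))\<^sup>2)"
proof -
  have "(\<Sum>i | in_range (tdim X) i. (norm (X $\<^sub>t i))\<^sup>2) =
      (\<Sum>q\<in>index_set (cdim X). \<Sum>p\<in>index_set (rdim X). (norm (ent X p q))\<^sup>2)"
    unfolding sum.cartesian_product
    by (rule sum.reindex_bij_witness[where i = "\<lambda>(q, p). (fst p, snd p, q)"
          and j = "\<lambda>(a, b, q). (q, (a, b))"])
       (auto simp: in_range_def index_set_def rdim_def cdim_def ent_def split: prod.splits)
  then show ?thesis by (simp add: frob_norm_def)
qed

lemma frob_norm_sq:
  "(frob_norm X)\<^sup>2 = (\<Sum>q\<in>index_set (cdim X). \<Sum>p\<in>index_set (rdim X). (norm (ent X p q))\<^sup>2)"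
  unfolding frob_norm_ent by (rule real_sqrt_pow2) (intro sum_nonneg, simp)

lemma frob_norm_nonneg: "frob_norm X \<ge> 0"
  unfolding frob_norm_ent by (intro real_sqrt_ge_zero sum_nonneg) simp

text \<open>Cauchy-Schwarz bounds each entry of the product by a row norm of \<open>X\<close> times
  a column norm of \<open>Y\<close>; the double sum of the squared bounds factors.\<close>

lemma frob_norm_mult_le:
  fixes X Y :: "'a::real_normed_algebra tensor4"
  assumes "cdim X = rdim Y"
  shows "frob_norm (X * Y) \<le> frob_norm X * frob_norm Y"
proof (rule power2_le_imp_le)
  let ?P = "index_set (rdim X)" and ?Q = "index_set (rdim Y)" and ?R = "index_set (cdim Y)"
  have le: "(norm (\<Sum>q\<in>?Q. ent X p q * ent Y q r))\<^sup>2 \<le>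
      (\<Sum>q\<in>?Q. (norm (ent X p q))\<^sup>2) * (\<Sum>q\<in>?Q. (norm (ent Y q r))\<^sup>2)" for p r
  proof -
    have "norm (\<Sum>q\<in>?Q. ent X p q * ent Y q r) \<le> (\<Sum>q\<in>?Q. norm (ent X p q) * norm (ent Y q r))"
      by (intro sum_norm_le norm_mult_ineq)
    also have "\<dots> \<le> L2_set (\<lambda>q. norm (ent X p q)) ?Q * L2_set (\<lambda>q. norm (ent Y q r)) ?Q"
      using L2_set_mult_ineq[of "\<lambda>q. norm (ent X p q)" "\<lambda>q. norm (ent Y q r)" ?Q] by simp
    finally have "(norm (\<Sum>q\<in>?Q. ent X p q * ent Y q r))\<^sup>2 \<le>
        (L2_set (\<lambda>q. norm (ent X p q)) ?Q * L2_set (\<lambda>q. norm (ent Y q r)) ?Q)\<^sup>2"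
      by (intro power_mono) simp_all
    then show ?thesis by (simp add: power_mult_distrib L2_set_def sum_nonneg)
  qed
  have "(frob_norm (X * Y))\<^sup>2 = (\<Sum>r\<in>?R. \<Sum>p\<in>?P. (norm (\<Sum>q\<in>?Q. ent X p q * ent Y q r))\<^sup>2)"
    using assms by (simp add: frob_norm_sq)
  also have "\<dots> \<le> (\<Sum>r\<in>?R. \<Sum>p\<in>?P. (\<Sum>q\<in>?Q. (norm (ent X p q))\<^sup>2) * (\<Sum>q\<in>?Q. (norm (ent Y q r))\<^sup>2))"
    by (intro sum_mono le)
  also have "\<dots> = (\<Sum>p\<in>?P. \<Sum>q\<in>?Q. (norm (ent X p q))\<^sup>2) * (frob_norm Y)\<^sup>2"
    by (simp add: frob_norm_sq flip: sum_distrib_left sum_distrib_right)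
  \<comment> \<open>The row norms sum with rows outermost, \<open>frob_norm_sq\<close> with columns
    outermost; hence the swap.\<close>
  also have "\<dots> = (frob_norm X * frob_norm Y)\<^sup>2"
    unfolding power_mult_distrib frob_norm_sq[of X] assms
    by (subst sum.swap) simp
  finally show "(frob_norm (X * Y))\<^sup>2 \<le> (frob_norm X * frob_norm Y)\<^sup>2" .
qed (simp add: frob_norm_nonneg)

text \<open>Pythagoras: \<open>Y\<close> is orthogonal to the columns of \<open>V\<close>, hence to
  every combination \<open>cplx V * U\<close>, and subtracting it from such a combination leaves at
  least the length of \<open>Y\<close>.\<close>

lemma frob_norm_le_orthogonal:
  fixes V :: "real tensor4" and U Y :: "complex tensor4"
  assumes "rdim V = rdim Y" "cdim V = rdim U" "cdim U = cdim Y"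
    and orth: "(cplx V)\<^sup>T * Y = zero_tensor K1 K2 L1 L2"
  shows "frob_norm Y \<le> frob_norm (cplx V * U - Y)"
proof (rule power2_le_imp_le)
  let ?P = "index_set (rdim Y)" and ?K = "index_set (rdim U)" and ?Q = "index_set (cdim Y)"
  define Z where "Z = cplx V * U"
  have dims: "rdim U = (K1, K2)" "cdim Y = (L1, L2)"
    using arg_cong[OF orth, of rdim] arg_cong[OF orth, of cdim] assms(1-3) by simp_all
  have orth': "(\<Sum>p\<in>?P. complex_of_real (ent V p k) * ent Y p q) = 0"
    if "k \<in> ?K" "q \<in> ?Q" for k q
  proof -
    have "ent ((cplx V)\<^sup>T * Y) k q = 0"
      unfolding orth using that dims by simp
    then show ?thesis using that assms(1-3) by simp
  qed
  \<comment> \<open>The entries of \<open>V\<close> are real, so conjugation affects only the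
    coefficients \<open>U\<close>, and the plain transpose in \<open>orth\<close> expresses
    orthogonality for the complex inner product.\<close>
  have inner: "(\<Sum>p\<in>?P. cnj (ent Z p q) * ent Y p q) = 0" if q: "q \<in> ?Q" for q
  proof -
    have "(\<Sum>p\<in>?P. cnj (ent Z p q) * ent Y p q) =
        (\<Sum>p\<in>?P. \<Sum>k\<in>?K. cnj (ent U k q) * (complex_of_real (ent V p k) * ent Y p q))"
      using q assms by (simp add: Z_def sum_distrib_left mult_ac)
    also have "\<dots> = (\<Sum>k\<in>?K. cnj (ent U k q) * (\<Sum>p\<in>?P. complex_of_real (ent V p k) * ent Y p q))"
      by (subst sum.swap) (simp add: sum_distrib_left)
    finally show ?thesis using q by (simp add: orth')
  qed
  have expand: "(norm (z - y))\<^sup>2 = (norm z)\<^sup>2 + (norm y)\<^sup>2 - 2 * Re (cnj z * y)" for z y :: complex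
    unfolding cmod_power2 by (simp add: power2_eq_square algebra_simps)
  have col: "(\<Sum>p\<in>?P. (norm (ent Y p q))\<^sup>2) \<le> (\<Sum>p\<in>?P. (norm (ent Z p q - ent Y p q))\<^sup>2)"
    if q: "q \<in> ?Q" for q
  proof -
    have "(\<Sum>p\<in>?P. (norm (ent Z p q - ent Y p q))\<^sup>2) =
        (\<Sum>p\<in>?P. (norm (ent Z p q))\<^sup>2) + (\<Sum>p\<in>?P. (norm (ent Y p q))\<^sup>2)
          - 2 * Re (\<Sum>p\<in>?P. cnj (ent Z p q) * ent Y p q)"
      by (simp only: expand sum.distrib sum_subtractf Re_sum sum_distrib_left)
    then show ?thesis by (simp add: inner[OF q] sum_nonneg)
  qed
  have "(frob_norm Y)\<^sup>2 \<le> (\<Sum>q\<in>?Q. \<Sum>p\<in>?P. (norm (ent Z p q - ent Y p q))\<^sup>2)"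
    unfolding frob_norm_sq by (intro sum_mono col)
  also have "\<dots> = (frob_norm (Z - Y))\<^sup>2"
    using assms by (simp add: frob_norm_sq Z_def)
  finally show "(frob_norm Y)\<^sup>2 \<le> (frob_norm (cplx V * U - Y))\<^sup>2" by (simp add: Z_def)
qed (rule frob_norm_nonneg)

section \<open>The rational block Arnoldi process\<close>

lemma arnoldi_stepE:
  fixes V :: "nat \<Rightarrow> real tensor4"
  assumes "rational_block_arnoldi J1 J2 K1 K2 m A B \<sigma> V H" "j \<in> {1..m}"
  obtains W :: "nat \<Rightarrow> real tensor4" where "invertible_tensor (A - \<sigma> j \<cdot>\<^sub>t id_tensor J1 J2)"
    and "W 0 = inverse_tensor (A - \<sigma> j \<cdot>\<^sub>t id_tensor J1 J2) * V j"
    and "\<And>i. i \<in> {1..j} \<Longrightarrow> H i j = (V i)\<^sup>T * W (i - 1)"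
    and "\<And>i. i \<in> {1..j} \<Longrightarrow> W i = W (i - 1) - V i * H i j"
    and "qr_decomposition J1 J2 K1 K2 (W j) (V (j + 1)) (H (j + 1) j)"
proof -
  note step = assms(1)[unfolded rational_block_arnoldi_def, THEN conjunct2, rule_format, OF assms(2)]
  obtain W where W: "W 0 = inverse_tensor (A - \<sigma> j \<cdot>\<^sub>t id_tensor J1 J2) * V j \<and>
      (\<forall>i\<in>{1..j}. H i j = (V i)\<^sup>T * W (i - 1) \<and> W i = W (i - 1) - V i * H i j) \<and>
      qr_decomposition J1 J2 K1 K2 (W j) (V (j + 1)) (H (j + 1) j)"
    using step[THEN conjunct2] by (rule exE)
  show thesis
    by (rule that[of W]) (use W step[THEN conjunct1] in simp_all)
qed

text \<open>Within the process only the QR factors have declared sizes. For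
  \<open>i \<le> j\<close>, \<open>H i j\<close> gets its rows from \<open>V i\<close> and its
  columns from the work tensor.\<close>

lemma arnoldi_dims:
  assumes "rational_block_arnoldi J1 J2 K1 K2 m A B \<sigma> V H"
  shows "i \<in> {1..m+1} \<Longrightarrow> rdim (V i) = (J1, J2)" "i \<in> {1..m+1} \<Longrightarrow> cdim (V i) = (K1, K2)"
    and "j \<in> {1..m} \<Longrightarrow> i \<in> {1..j+1} \<Longrightarrow> rdim (H i j) = (K1, K2)"
    and "j \<in> {1..m} \<Longrightarrow> i \<in> {1..j+1} \<Longrightarrow> cdim (H i j) = (K1, K2)"
proof -
  have qr: "rdim Q = (J1, J2) \<and> cdim Q = (K1, K2) \<and> rdim R = (K1, K2) \<and> cdim R = (K1, K2)"
    if "qr_decomposition J1 J2 K1 K2 X Q R" for X Q R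
    using that by (simp add: qr_decomposition_def tensors_iff)
  have V1: "rdim (V 1) = (J1, J2) \<and> cdim (V 1) = (K1, K2)"
    using assms qr by (auto simp: rational_block_arnoldi_def)
  have step: "rdim (V (j + 1)) = (J1, J2) \<and> cdim (V (j + 1)) = (K1, K2) \<and>
      rdim (H (j + 1) j) = (K1, K2) \<and> cdim (H (j + 1) j) = (K1, K2)" if "j \<in> {1..m}" for j
    by (rule arnoldi_stepE[OF assms that]) (drule qr, simp)
  have V: "rdim (V i) = (J1, J2) \<and> cdim (V i) = (K1, K2)" if "i \<in> {1..m+1}" for i
  proof (cases "i = 1")
    case False
    then have "i - 1 \<in> {1..m}" "i - 1 + 1 = i" using that by auto
    then show ?thesis using step[of "i - 1"] by simp
  qed (use V1 in simp)
  then show "i \<in> {1..m+1} \<Longrightarrow> rdim (V i) = (J1, J2)" "i \<in> {1..m+1} \<Longrightarrow> cdim (V i) = (K1, K2)"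
    by simp_all
  have H: "rdim (H i j) = (K1, K2) \<and> cdim (H i j) = (K1, K2)"
    if j: "j \<in> {1..m}" and i: "i \<in> {1..j+1}" for i j
  proof (cases "i = j + 1")
    case True
    then show ?thesis using step[OF j] by simp
  next
    case False
    with i have i: "i \<in> {1..j}" by simp
    show ?thesis
    proof (rule arnoldi_stepE[OF assms j])
      fix W assume W0: "W 0 = inverse_tensor (A - \<sigma> j \<cdot>\<^sub>t id_tensor J1 J2) * V j"
        and HW: "\<And>i. i \<in> {1..j} \<Longrightarrow> H i j = (V i)\<^sup>T * W (i - 1)"
        and W: "\<And>i. i \<in> {1..j} \<Longrightarrow> W i = W (i - 1) - V i * H i j"
      \<comment> \<open>A difference takes its size from its left argument, so every pass preserves
        the size of \<open>W 0\<close>.\<close>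
      have "cdim (W n) = (K1, K2)" if "n \<le> j" for n
        using that
      proof (induction n)
        case 0
        then show ?case using V[of j] j by (simp add: W0)
      next
        case (Suc n)
        then show ?case using W[of "Suc n"] by simp
      qed
      from this[of "i - 1"] show ?thesis using HW[OF i] V[of i] i j by auto
    qed
  qed
  then show "j \<in> {1..m} \<Longrightarrow> i \<in> {1..j+1} \<Longrightarrow> rdim (H i j) = (K1, K2)"
    "j \<in> {1..m} \<Longrightarrow> i \<in> {1..j+1} \<Longrightarrow> cdim (H i j) = (K1, K2)"
    by simp_all
qed

text \<open>The \<open>W j\<close> obtained is the work tensor of step \<open>j\<close> before any
  orthogonalization. Undoing the Gram-Schmidt passes and the final QR decomposition expands it in
  the blocks 1 to \<open>j + 1\<close>; this is stated by entries because tensors carry no addition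
  here.\<close>

lemma arnoldi_work_tensors:
  assumes A: "rdim A = (J1, J2)" "cdim A = (J1, J2)"
    and arnoldi: "rational_block_arnoldi J1 J2 K1 K2 m A B \<sigma> V H"
  obtains W where
    "\<And>j. j \<in> {1..m} \<Longrightarrow> rdim (W j) = (J1, J2) \<and> cdim (W j) = (K1, K2)"
    and "\<And>j. j \<in> {1..m} \<Longrightarrow> A * W j - \<sigma> j \<cdot>\<^sub>t W j = V j"
    and "\<And>j p q. j \<in> {1..m} \<Longrightarrow> p \<in> index_set (J1, J2) \<Longrightarrow> q \<in> index_set (K1, K2) \<Longrightarrow>
      ent (W j) p q = (\<Sum>i\<le>j. ent (V (Suc i) * H (Suc i) j) p q)"
proof -
  have "\<exists>W. (rdim W = (J1, J2) \<and> cdim W = (K1, K2)) \<and> A * W - \<sigma> j \<cdot>\<^sub>t W = V j \<and>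
      (\<forall>p\<in>index_set (J1, J2). \<forall>q\<in>index_set (K1, K2). ent W p q = (\<Sum>i\<le>j. ent (V (Suc i) * H (Suc i) j) p q))"
    if j: "j \<in> {1..m}" for j
  proof -
    let ?S = "A - \<sigma> j \<cdot>\<^sub>t id_tensor J1 J2"
    show ?thesis
    proof (rule arnoldi_stepE[OF arnoldi j])
      fix W assume inv: "invertible_tensor ?S"
        and W0: "W 0 = inverse_tensor ?S * V j"
        and W: "\<And>i. i \<in> {1..j} \<Longrightarrow> W i = W (i - 1) - V i * H i j"
        and qr: "qr_decomposition J1 J2 K1 K2 (W j) (V (j + 1)) (H (j + 1) j)"
      from qr have Wj: "W j = V (j + 1) * H (j + 1) j" by (simp add: qr_decomposition_def)
      have S: "rdim ?S = (J1, J2)" using A by simp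
      note S_inv = inverse_tensor[OF inv S]
      have Vj: "rdim (V j) = (J1, J2)" "cdim (V j) = (K1, K2)"
        using arnoldi_dims[OF arnoldi] j by auto
      have dW: "rdim (W n) = (J1, J2) \<and> cdim (W n) = (K1, K2)" if "n \<le> j" for n
        using that
      proof (induction n)
        case 0
        then show ?case using S_inv Vj by (simp add: W0)
      next
        case (Suc n)
        then show ?case using W[of "Suc n"] by simp
      qed
      have "V j = ?S * W 0"
        using S_inv Vj A by (simp add: W0 tensor_id_mult flip: tensor_assoc)
      also have "\<dots> = A * W 0 - \<sigma> j \<cdot>\<^sub>t W 0"
        using A dW[of 0] by (simp add: tensor_minus_mult tensor_smult_mult tensor_id_mult)
      finally have eq: "A * W 0 - \<sigma> j \<cdot>\<^sub>t W 0 = V j" ..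
      \<comment> \<open>Telescoping: what the first \<open>n\<close> passes removed, plus what
        remains. At \<open>n = j\<close> the remainder \<open>V (j + 1) * H (j + 1) j\<close>
        supplies the last summand.\<close>
      have "ent (W 0) p q = (\<Sum>i<n. ent (V (Suc i) * H (Suc i) j) p q) + ent (W n) p q"
        if "n \<le> j" "p \<in> index_set (J1, J2)" "q \<in> index_set (K1, K2)" for n p q
        using that
      proof (induction n)
        case (Suc n)
        have "ent (W (Suc n)) p q = ent (W n) p q - ent (V (Suc n) * H (Suc n) j) p q"
          using W[of "Suc n"] dW[of n] Suc.prems by (simp del: ent_times)
        then show ?case using Suc by (simp del: ent_times)
      qed simp
      from this[of j] have "\<forall>p\<in>index_set (J1, J2). \<forall>q\<in>index_set (K1, K2).
          ent (W 0) p q = (\<Sum>i\<le>j. ent (V (Suc i) * H (Suc i) j) p q)"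
        by (simp add: Wj lessThan_Suc_atMost[symmetric] del: ent_times)
      with dW[of 0] eq show ?thesis by blast
    qed
  qed
  then obtain W where "\<forall>j\<in>{1..m}. (rdim (W j) = (J1, J2) \<and> cdim (W j) = (K1, K2)) \<and>
      A * W j - \<sigma> j \<cdot>\<^sub>t W j = V j \<and> (\<forall>p\<in>index_set (J1, J2). \<forall>q\<in>index_set (K1, K2).
        ent (W j) p q = (\<Sum>i\<le>j. ent (V (Suc i) * H (Suc i) j) p q))"
    by (rule bchoice[OF ballI, THEN exE])
  then show thesis by (intro that[of W]) blast+
qed

text \<open>The real identities behind the error bound. A difference from the zero tensor stands for
  a negative, as there is no unary minus.\<close>

lemma arnoldi_projection:
  fixes A B Vm Hm G :: "real tensor4"
  assumes A: "rdim A = (J1, J2)" "cdim A = (J1, J2)"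
    and m: "m \<ge> 1"
    and arnoldi: "rational_block_arnoldi J1 J2 K1 K2 m A B \<sigma> V H"
    and orthonormal: "orthonormal_blocks K1 K2 (m + 1) V"
    and last_point: "\<sigma> m = 0"
    and Vm: "Vm = block_concat J1 J2 K1 K2 m V"
    and Hm: "Hm = block_hessenberg K1 K2 m H"
    and Hm_invertible: "invertible_tensor Hm"
    and G: "G = A * V (m + 1) * H (m + 1) m * (mode4_block K2 m (id_tensor K1 (m * K2)))\<^sup>T
      * inverse_tensor Hm"
    and Q: "Q = id_tensor J1 J2 - Vm * Vm\<^sup>T"
  shows "Vm\<^sup>T * Vm = id_tensor K1 (m * K2)"
    and "Q * Vm = zero_tensor J1 J2 K1 (m * K2)"
    and "Q * B = zero_tensor J1 J2 K1 K2"
    and "Q * (A * Vm) = zero_tensor J1 J2 K1 (m * K2) - Q * G"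
proof -
  note dims = arnoldi_dims[OF arnoldi]
  have dVm: "rdim Vm = (J1, J2)" "cdim Vm = (K1, m * K2)" by (simp_all add: Vm)
  have dQ: "rdim Q = (J1, J2)" "cdim Q = (J1, J2)" by (simp_all add: Q)
  have dHm: "rdim Hm = (K1, m * K2)" "cdim Hm = (K1, m * K2)" by (simp_all add: Hm)
  note Hm_inv = inverse_tensor[OF Hm_invertible dHm(1)]
  show VV: "Vm\<^sup>T * Vm = id_tensor K1 (m * K2)"
    unfolding Vm using dims orthonormal by (intro block_concat_orthonormal) auto
  show QVm: "Q * Vm = zero_tensor J1 J2 K1 (m * K2)"
    using dVm by (simp add: Q tensor_minus_mult tensor_assoc VV tensor_id_mult tensor_mult_id tensor_minus_self)
  have QV: "Q * V i = zero_tensor J1 J2 K1 K2" if i: "i \<in> {1..m}" for i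
  proof -
    have "Q * V i = mode4_block K2 i (Q * Vm)"
      using i dims[of i] dQ by (subst mode4_block_times[of _ _ _ m]) (simp_all add: Vm mode4_block_concat)
    \<comment> \<open>Writing zero as a product with \<open>Vm\<close> lets
      \<open>mode4_block_times\<close> extract the block on this side too.\<close>
    also have "Q * Vm = zero_tensor J1 J2 J1 J2 * Vm"
      using dVm by (simp add: QVm tensor_zero_mult)
    also have "mode4_block K2 i \<dots> = zero_tensor J1 J2 J1 J2 * V i"
      using i dims[of i] by (subst mode4_block_times[of _ _ _ m]) (simp_all add: Vm mode4_block_concat)
    finally show ?thesis using i dims[of i] by (simp add: tensor_zero_mult)
  qed
  show "Q * B = zero_tensor J1 J2 K1 K2"
  proof -
    have B: "B = V 1 * H 1 0" "rdim (H 1 0) = (K1, K2)" "cdim (H 1 0) = (K1, K2)"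
      using arnoldi by (auto simp: rational_block_arnoldi_def qr_decomposition_def tensors_iff)
    have "Q * B = Q * V 1 * H 1 0"
      unfolding B(1) using dims[of 1] B dQ by (subst tensor_assoc) simp_all
    then show ?thesis using QV[of 1] m B by (simp add: tensor_zero_mult)
  qed
  obtain W where dW: "\<And>j. j \<in> {1..m} \<Longrightarrow> rdim (W j) = (J1, J2) \<and> cdim (W j) = (K1, K2)"
    and AW: "\<And>j. j \<in> {1..m} \<Longrightarrow> A * W j - \<sigma> j \<cdot>\<^sub>t W j = V j"
    and W: "\<And>j p q. j \<in> {1..m} \<Longrightarrow> p \<in> index_set (J1, J2) \<Longrightarrow> q \<in> index_set (K1, K2) \<Longrightarrow>
      ent (W j) p q = (\<Sum>i\<le>j. ent (V (Suc i) * H (Suc i) j) p q)"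
    using arnoldi_work_tensors[OF A arnoldi] by blast
  \<comment> \<open>For \<open>j < m\<close> the expansion of \<open>W j\<close> stops at block
    \<open>j + 1 \<le> m\<close>, so \<open>Q\<close> kills every term.\<close>
  have QW: "Q * W j = zero_tensor J1 J2 K1 K2" if j: "j \<in> {1..m}" "j \<noteq> m" for j
  proof (rule tensor_ext)
    fix p q assume pq: "p \<in> index_set (rdim (Q * W j))" "q \<in> index_set (cdim (Q * W j))"
    then have p: "p \<in> index_set (J1, J2)" and q: "q \<in> index_set (K1, K2)" using dQ dW[OF j(1)] by simp_all
    have zero: "ent (Q * (V (Suc i) * H (Suc i) j)) p q = 0" if "i \<le> j" for i
    proof -
      have "Q * (V (Suc i) * H (Suc i) j) = Q * V (Suc i) * H (Suc i) j"
        using dims[of "Suc i"] dims(3,4)[of j "Suc i"] that j dQ by (subst tensor_assoc) simp_all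
      then show ?thesis
        using QV[of "Suc i"] dims(3,4)[of j "Suc i"] that j p q by (simp add: tensor_zero_mult)
    qed
    \<comment> \<open>Only the instance of \<open>ent_times\<close> with left factor
      \<open>Q\<close> is active; the products \<open>V (Suc i) * H (Suc i) j\<close> stay
      folded.\<close>
    have "ent (Q * W j) p q = (\<Sum>x\<in>index_set (J1, J2). \<Sum>i\<le>j. ent Q p x * ent (V (Suc i) * H (Suc i) j) x q)"
      using p q dQ dW[OF j(1)] by (simp add: W[OF j(1)] sum_distrib_left del: ent_times add: ent_times[of p Q])
    also have "\<dots> = (\<Sum>i\<le>j. ent (Q * (V (Suc i) * H (Suc i) j)) p q)"
      using p q dQ dims(3,4)[of j] j
      by (subst sum.swap) (intro sum.cong, simp_all del: ent_times add: ent_times[of p Q])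
    also have "\<dots> = ent (zero_tensor J1 J2 K1 K2) p q" using p q by (simp add: zero del: ent_times)
    finally show "ent (Q * W j) p q = ent (zero_tensor J1 J2 K1 K2) p q" .
  qed (use dQ dW[OF j(1)] in simp_all)
  have QAW: "Q * A * W j = zero_tensor J1 J2 K1 K2" if j: "j \<in> {1..m}" for j
  proof -
    have "Q * (A * W j - \<sigma> j \<cdot>\<^sub>t W j) = zero_tensor J1 J2 K1 K2"
      by (simp only: AW[OF j] QV[OF j])
    \<comment> \<open>For \<open>j = m\<close> the scalar is 0; for the other \<open>j\<close> the
      tensor is zero by \<open>QW\<close>.\<close>
    moreover have "\<sigma> j \<cdot>\<^sub>t (Q * W j) = zero_tensor J1 J2 K1 K2"
      using QW[OF j] last_point dQ dW[OF j]
      by (cases "j = m") (simp_all add: tensor_smult_zero tensor_zero_smult)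
    ultimately show ?thesis
      using A dQ dW[OF j] by (simp add: tensor_mult_minus tensor_mult_smult tensor_assoc tensor_minus_zero)
  qed
  let ?W = "block_concat J1 J2 K1 K2 m W"
  let ?E = "mode4_block K2 m (id_tensor K1 (m * K2)) :: real tensor4"
  have Vl: "rdim (V (m + 1)) = (J1, J2)" "cdim (V (m + 1)) = (K1, K2)"
    and Hl: "rdim (H (m + 1) m) = (K1, K2)" "cdim (H (m + 1) m) = (K1, K2)"
    using dims[of "m + 1"] dims(3,4)[of m "m + 1"] m by simp_all
  have QAW': "Q * A * ?W = zero_tensor J1 J2 K1 (m * K2)"
    using dQ A dW QAW by (intro times_block_concat_eq_zero) simp_all
  have VH: "Vm * Hm = ?W - V (m + 1) * H (m + 1) m * ?E\<^sup>T"
    unfolding Vm Hm using dims W m by (intro block_concat_hessenberg) auto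
  \<comment> \<open>Inserting \<open>Hm\<close> times its inverse exposes \<open>Vm * Hm\<close>, to
    which the Arnoldi relation applies.\<close>
  have "Q * (A * Vm) = Q * A * (Vm * Hm) * inverse_tensor Hm"
    using dQ A dVm dHm Hm_inv by (simp add: tensor_assoc tensor_mult_id)
  also have "\<dots> = Q * A * ?W * inverse_tensor Hm - Q * G"
    unfolding VH G using dQ A Vl Hl Hm_inv
    by (simp add: tensor_mult_minus tensor_minus_mult tensor_assoc)
  finally show "Q * (A * Vm) = zero_tensor J1 J2 K1 (m * K2) - Q * G"
    using Hm_inv by (simp add: QAW' tensor_zero_mult)
qed

section \<open>The residual of the reduced model and the error bound\<close>

theorem theorem3p1:
  fixes A B C :: "real tensor4"
    and V :: "nat \<Rightarrow> real tensor4" and H :: "nat \<Rightarrow> nat \<Rightarrow> real tensor4"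
    and \<sigma> :: "nat \<Rightarrow> real"
    and Vm Hm Em Am Bm Cm :: "real tensor4"
    and F Fm :: "complex \<Rightarrow> complex tensor4"
    and I1 I2 J1 J2 K1 K2 m :: nat and s :: complex
  assumes A: "A \<in> tensors J1 J2 J1 J2"
    and B: "B \<in> tensors J1 J2 K1 K2"
    and C: "C \<in> tensors I1 I2 J1 J2"
    and m: "m \<ge> 1"
    and arnoldi: "rational_block_arnoldi J1 J2 K1 K2 m A B \<sigma> V H"
    and orthonormal: "orthonormal_blocks K1 K2 (m + 1) V"
    and last_point: "\<sigma> m = 0"
    and Vm: "Vm = block_concat J1 J2 K1 K2 m V"
    and Hm: "Hm = block_hessenberg K1 K2 m H"
    and Hm_invertible: "invertible_tensor Hm"
    and Em: "Em = mode4_block K2 m (id_tensor K1 (m * K2))"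
    and Am: "Am = Vm\<^sup>T * A * Vm"
    and Bm: "Bm = Vm\<^sup>T * B"
    and Cm: "Cm = C * Vm"
    and F: "\<And>z. F z = cplx C * inverse_tensor (z \<cdot>\<^sub>t id_tensor J1 J2 - cplx A) * cplx B"
    and Fm: "\<And>z. Fm z =
      cplx Cm * inverse_tensor (z \<cdot>\<^sub>t id_tensor K1 (m * K2) - cplx Am) * cplx Bm"
    and s: "invertible_tensor (s \<cdot>\<^sub>t id_tensor J1 J2 - cplx A)"
    and sm: "invertible_tensor (s \<cdot>\<^sub>t id_tensor K1 (m * K2) - cplx Am)"
  shows "frob_norm (F s - Fm s) \<le>
    frob_norm (cplx C * inverse_tensor (s \<cdot>\<^sub>t id_tensor J1 J2 - cplx A)) *
    frob_norm (cplx (A * V (m + 1) * H (m + 1) m * Em\<^sup>T * inverse_tensor Hm) *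
      inverse_tensor (s \<cdot>\<^sub>t id_tensor K1 (m * K2) - cplx Am) * cplx Bm)"
proof -
  let ?I = "id_tensor J1 J2 :: complex tensor4" and ?Im = "id_tensor K1 (m * K2) :: complex tensor4"
  define R where "R = inverse_tensor (s \<cdot>\<^sub>t ?I - cplx A)"
  define S where "S = inverse_tensor (s \<cdot>\<^sub>t ?Im - cplx Am)"
  define G where "G = A * V (m + 1) * H (m + 1) m * Em\<^sup>T * inverse_tensor Hm"
  define Q :: "real tensor4" where "Q = id_tensor J1 J2 - Vm * Vm\<^sup>T"
  define X where "X = S * cplx Bm"
  define Y where "Y = cplx B - (s \<cdot>\<^sub>t ?I - cplx A) * (cplx Vm * X)"
  \<comment> \<open>\<open>cplx Vm * U\<close> is the component of \<open>cplx G * X\<close> in the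
    range of \<open>Vm\<close>, the part that \<open>Q\<close> removes.\<close>
  define U where "U = (cplx Vm)\<^sup>T * (cplx G * X)"
  have d [simp]: "rdim A = (J1, J2)" "cdim A = (J1, J2)" "rdim B = (J1, J2)" "cdim B = (K1, K2)"
    "rdim C = (I1, I2)" "cdim C = (J1, J2)"
    using A B C by (simp_all add: tensors_iff)
  have dVm [simp]: "rdim Vm = (J1, J2)" "cdim Vm = (K1, m * K2)" by (simp_all add: Vm)
  have dm [simp]: "rdim Am = (K1, m * K2)" "cdim Am = (K1, m * K2)"
    "rdim Bm = (K1, m * K2)" "cdim Bm = (K1, K2)"
    by (simp_all add: Am Bm)
  have RS: "R * (s \<cdot>\<^sub>t ?I - cplx A) = ?I" "(s \<cdot>\<^sub>t ?Im - cplx Am) * S = ?Im"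
    and dRS [simp]: "rdim R = (J1, J2)" "cdim R = (J1, J2)" "rdim S = (K1, m * K2)" "cdim S = (K1, m * K2)"
    unfolding R_def S_def using inverse_tensor[OF s] inverse_tensor[OF sm] by simp_all
  have Hm_dims: "rdim Hm = (K1, m * K2)" by (simp add: Hm)
  have dG [simp]: "rdim G = (J1, J2)" "cdim G = (K1, m * K2)"
    using inverse_tensor(4)[OF Hm_invertible Hm_dims] by (simp_all add: G_def)
  have dQ [simp]: "rdim Q = (J1, J2)" "cdim Q = (J1, J2)" by (simp_all add: Q_def)
  have dX [simp]: "rdim X = (K1, m * K2)" "cdim X = (K1, K2)" by (simp_all add: X_def)
  have dY [simp]: "rdim Y = (J1, J2)" "cdim Y = (K1, K2)" by (simp_all add: Y_def)
  have dU [simp]: "rdim U = (K1, m * K2)" "cdim U = (K1, K2)" by (simp_all add: U_def)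
  note proj = arnoldi_projection[OF d(1,2) m arnoldi orthonormal last_point Vm Hm Hm_invertible
      G_def[unfolded Em] Q_def]
  \<comment> \<open>As \<open>s\<close> is complex, the real identities are carried over by
    \<open>cplx\<close>.\<close>
  have VV: "(cplx Vm)\<^sup>T * cplx Vm = ?Im"
    using arg_cong[OF proj(1), of cplx] by (simp add: cplx_times cplx_transpose cplx_id)
  have QV: "cplx Q * cplx Vm = zero_tensor J1 J2 K1 (m * K2)"
    using arg_cong[OF proj(2), of cplx] by (simp add: cplx_times cplx_zero)
  have QB: "cplx Q * cplx B = zero_tensor J1 J2 K1 K2"
    using arg_cong[OF proj(3), of cplx] by (simp add: cplx_times cplx_zero)
  have QAV: "cplx Q * (cplx A * cplx Vm) = zero_tensor J1 J2 K1 (m * K2) - cplx Q * cplx G"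
    using arg_cong[OF proj(4), of cplx] by (simp add: cplx_times cplx_zero cplx_minus)
  have cQ: "cplx Q = ?I - cplx Vm * (cplx Vm)\<^sup>T"
    by (simp add: Q_def cplx_minus cplx_id cplx_times cplx_transpose)
  have cAm: "cplx Am = (cplx Vm)\<^sup>T * (cplx A * cplx Vm)" and cBm: "cplx Bm = (cplx Vm)\<^sup>T * cplx B"
    by (simp_all add: Am Bm cplx_times cplx_transpose tensor_assoc)

  have Y_eq: "Y = cplx B - (s \<cdot>\<^sub>t (cplx Vm * X) - cplx A * cplx Vm * X)"
    by (simp add: Y_def tensor_minus_mult tensor_smult_mult tensor_id_mult tensor_assoc)
  \<comment> \<open>The Galerkin condition: \<open>X\<close> solves the projected system, and
    orthonormality reduces the projected residual to the residual of that system.\<close>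
  have VY: "(cplx Vm)\<^sup>T * Y = zero_tensor K1 (m * K2) K1 K2"
  proof -
    have "(cplx Vm)\<^sup>T * Y = cplx Bm - (s \<cdot>\<^sub>t X - cplx Am * X)"
      by (simp add: Y_eq cAm cBm tensor_mult_minus tensor_mult_smult tensor_assoc)
         (simp add: VV tensor_id_mult flip: tensor_assoc)
    also have "s \<cdot>\<^sub>t X - cplx Am * X = (s \<cdot>\<^sub>t ?Im - cplx Am) * X"
      by (simp add: tensor_minus_mult tensor_smult_mult tensor_id_mult)
    also have "\<dots> = cplx Bm"
      using RS(2) by (simp add: X_def tensor_id_mult flip: tensor_assoc)
    finally show ?thesis by (simp add: tensor_minus_self)
  qed
  have "Y = cplx Q * Y"
    by (simp add: cQ tensor_minus_mult tensor_assoc VY tensor_mult_zero tensor_minus_zero tensor_id_mult)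
  also have "\<dots> = cplx Q * cplx B - (s \<cdot>\<^sub>t (cplx Q * cplx Vm * X) - cplx Q * (cplx A * cplx Vm) * X)"
    by (simp add: Y_eq tensor_mult_minus tensor_mult_smult tensor_assoc)
  \<comment> \<open>The nested differences from zero amount to the negative of
    \<open>cplx Q * cplx G * X\<close>.\<close>
  also have "\<dots> = zero_tensor J1 J2 K1 K2 - (zero_tensor J1 J2 K1 K2
      - (zero_tensor J1 J2 K1 K2 - cplx Q * cplx G * X))"
    by (simp add: QB QV QAV tensor_minus_mult tensor_zero_mult tensor_smult_zero)
  also have "cplx Q * cplx G * X = cplx G * X - cplx Vm * U"
    by (simp add: cQ U_def tensor_minus_mult tensor_id_mult tensor_assoc)
  finally have Y: "Y = zero_tensor J1 J2 K1 K2 - (zero_tensor J1 J2 K1 K2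
      - (zero_tensor J1 J2 K1 K2 - (cplx G * X - cplx Vm * U)))" .
  \<comment> \<open>This has the form needed for the Pythagorean bound: a combination of the columns
    of \<open>Vm\<close> minus the orthogonal \<open>Y\<close>.\<close>
  have "cplx Vm * U - Y = cplx G * X"
    by (rule tensor_ext) (simp_all add: Y del: ent_times)
  then have norm_Y: "frob_norm Y \<le> frob_norm (cplx G * X)"
    using frob_norm_le_orthogonal[OF _ _ _ VY, of U] by simp

  have "F s - Fm s = cplx C * R * cplx B - cplx C * cplx Vm * X"
    by (simp add: F Fm Cm cplx_times X_def R_def[symmetric] S_def[symmetric] tensor_assoc)
  \<comment> \<open>Inserting the identity as \<open>R\<close> times its inverse gives both terms
    the left factor \<open>cplx C * R\<close>; what is left is the residual
    \<open>Y\<close>.\<close>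
  also have "cplx C * cplx Vm * X = cplx C * (R * (s \<cdot>\<^sub>t ?I - cplx A)) * (cplx Vm * X)"
    by (simp add: RS tensor_mult_id tensor_assoc)
  also have "cplx C * R * cplx B - \<dots> = cplx C * R * Y"
    by (simp add: Y_def tensor_mult_minus[of "cplx C * R"]) (simp add: tensor_assoc)
  finally have "frob_norm (F s - Fm s) \<le> frob_norm (cplx C * R) * frob_norm Y"
    by (simp add: frob_norm_mult_le)
  also have "\<dots> \<le> frob_norm (cplx C * R) * frob_norm (cplx G * X)"
    by (intro mult_left_mono norm_Y frob_norm_nonneg)
  also have "cplx G * X = cplx G * S * cplx Bm"
    by (simp add: X_def tensor_assoc)
  finally show ?thesis by (simp add: R_def S_def G_def)
qed

end
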